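(* Let $n\ge 3$ and let $$G_n=\Big\langle g_1,\dots,g_n\ \Big|\ g_ig_j=g_jg_i\ (1\le i,j\le n),\ \ \prod_{j\ne k}g_j=g_k\ (1\le k\le n)\Big\rangle .$$ Then the abelian group $G_n$ is isomorphic to $C_2^{\,n-2}\times C_{2n-4}$.
   Context: $C_m$ denotes the cyclic group of order $m$. In the product $\prod_{j\neq k} g_j$ the index $j$ runs over $\{1,\dots,n\}\setminus\{k\}$. *)

theory Defs
  imports "HOL-Algebra.Product_Groups"
begin

text \<open>
  A word over \<open>S\<close> is a list of letters, where \<open>(x, True)\<close> stands for the generator \<open>x\<close> and
  \<open>(x, False)\<close> for its formal inverse.  The free group on \<open>S\<close> consists of the words over \<open>S\<close> modulo
  the equivalence relation generated by cancelling adjacent mutually inverse letters.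
\<close>

type_synonym 'a word = "('a \<times> bool) list"

abbreviation words :: "'a set \<Rightarrow> 'a word set" where
  "words S \<equiv> lists (S \<times> UNIV)"

inductive_set free_group_rel :: "'a set \<Rightarrow> ('a word \<times> 'a word) set" for S :: "'a set" where
  refl: "w \<in> words S \<Longrightarrow> (w, w) \<in> free_group_rel S"
| sym: "(v, w) \<in> free_group_rel S \<Longrightarrow> (w, v) \<in> free_group_rel S"
| trans: "(u, v) \<in> free_group_rel S \<Longrightarrow> (v, w) \<in> free_group_rel S \<Longrightarrow> (u, w) \<in> free_group_rel S"
| cancel: "u \<in> words S \<Longrightarrow> v \<in> words S \<Longrightarrow> x \<in> S \<Longrightarrow>
    (u @ [(x, b), (x, \<not> b)] @ v, u @ v) \<in> free_group_rel S"

definition word_class :: "'a set \<Rightarrow> 'a word \<Rightarrow> 'a word set" where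
  "word_class S w = free_group_rel S `` {w}"

definition free_group :: "'a set \<Rightarrow> 'a word set monoid" where
  "free_group S =
    \<lparr>carrier = words S // free_group_rel S,
     monoid.mult = (\<lambda>A B. \<Union>u\<in>A. \<Union>v\<in>B. word_class S (u @ v)),
     one = word_class S []\<rparr>"

definition normal_closure :: "('a, 'b) monoid_scheme \<Rightarrow> 'a set \<Rightarrow> 'a set" where
  "normal_closure G R = \<Inter>{N. N \<lhd> G \<and> R \<subseteq> N}"

text \<open>
  A pair \<open>(u, v)\<close> in \<open>R\<close> stands for the defining relation \<open>u = v\<close>; it contributes the relator
  \<open>u v\<^sup>-\<^sup>1\<close>.
\<close>

definition presented_group :: "'a set \<Rightarrow> ('a word \<times> 'a word) set \<Rightarrow> 'a word set set monoid" where
  "presented_group S R =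
    free_group S Mod
      normal_closure (free_group S)
        {word_class S u \<otimes>\<^bsub>free_group S\<^esub> inv\<^bsub>free_group S\<^esub> word_class S v | u v. (u, v) \<in> R}"

abbreviation gen :: "'a \<Rightarrow> 'a \<times> bool" where
  "gen x \<equiv> (x, True)"

text \<open>
  The generator \<open>g\<^sub>i\<close> is represented by the index \<open>i\<close>.  The product over \<open>j \<noteq> k\<close> is written as a
  word with the indices in increasing order; in the presence of the commutation relations the
  order is immaterial.
\<close>

definition G_relations :: "nat \<Rightarrow> (nat word \<times> nat word) set" where
  "G_relations n =
    {([gen i, gen j], [gen j, gen i]) | i j. i \<in> {1..n} \<and> j \<in> {1..n}} \<union>
    {(map gen (filter (\<lambda>j. j \<noteq> k) [1..<Suc n]), [gen k]) | k. k \<in> {1..n}}"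

definition G_pres :: "nat \<Rightarrow> nat word set set monoid" where
  "G_pres n = presented_group {1..n} (G_relations n)"


lemma free_group_rel_words:
  "(u, v) \<in> free_group_rel S \<Longrightarrow> u \<in> words S \<and> v \<in> words S"
  by (induction rule: free_group_rel.induct) auto

lemma equiv_free_group_rel: "equiv (words S) (free_group_rel S)"
proof (rule equivI)
  show "free_group_rel S \<subseteq> words S \<times> words S"
    using free_group_rel_words by fast
  show "refl_on (words S) (free_group_rel S)"
    by (rule refl_onI) (rule free_group_rel.refl)
  show "sym (free_group_rel S)"
    by (rule symI) (rule free_group_rel.sym)
  show "trans (free_group_rel S)"
    by (rule transI) (rule free_group_rel.trans)
qed

lemma free_group_rel_append_left:
  "(u, v) \<in> free_group_rel S \<Longrightarrow> w \<in> words S \<Longrightarrow> (w @ u, w @ v) \<in> free_group_rel S"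
proof (induction rule: free_group_rel.induct)
  case (cancel u v x b)
  then show ?case using free_group_rel.cancel[of "w @ u" S v x b] by auto
next
  case (refl u)
  then show ?case using free_group_rel.refl[of "w @ u" S] by auto
next
  case (sym u v)
  then show ?case using free_group_rel.sym by simp
next
  case (trans u v z)
  then show ?case using free_group_rel.trans by metis
qed

lemma free_group_rel_append_right:
  "(u, v) \<in> free_group_rel S \<Longrightarrow> w \<in> words S \<Longrightarrow> (u @ w, v @ w) \<in> free_group_rel S"
proof (induction rule: free_group_rel.induct)
  case (cancel u v x b)
  then show ?case using free_group_rel.cancel[of u S "v @ w" x b] by auto
next
  case (refl u)
  then show ?case using free_group_rel.refl[of "u @ w" S] by auto
next
  case (sym u v)
  then show ?case using free_group_rel.sym by simp
next
  case (trans u v z)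
  then show ?case using free_group_rel.trans by metis
qed

lemma word_class_eq_iff:
  "u \<in> words S \<Longrightarrow> v \<in> words S \<Longrightarrow> word_class S u = word_class S v \<longleftrightarrow> (u, v) \<in> free_group_rel S"
  unfolding word_class_def by (rule eq_equiv_class_iff[OF equiv_free_group_rel])

lemma carrier_free_group: "carrier (free_group S) = word_class S ` words S"
  by (auto simp: free_group_def quotient_def word_class_def)

lemma one_free_group: "\<one>\<^bsub>free_group S\<^esub> = word_class S []"
  by (simp add: free_group_def)

lemma mult_free_group:
  assumes "u \<in> words S" "v \<in> words S"
  shows "word_class S u \<otimes>\<^bsub>free_group S\<^esub> word_class S v = word_class S (u @ v)"
proof -
  have *: "word_class S (u' @ v') = word_class S (u @ v)"
    if "u' \<in> word_class S u" "v' \<in> word_class S v" for u' v'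
  proof -
    have uv: "(u, u') \<in> free_group_rel S" "(v, v') \<in> free_group_rel S"
      using that by (auto simp: word_class_def)
    then have w: "u' \<in> words S" "v' \<in> words S"
      using free_group_rel_words by blast+
    have "(u @ v, u' @ v') \<in> free_group_rel S"
      using free_group_rel_append_right[OF uv(1) assms(2)] free_group_rel_append_left[OF uv(2) w(1)]
      by (rule free_group_rel.trans)
    then show ?thesis
      by (subst word_class_eq_iff) (use w assms in \<open>simp_all add: free_group_rel.sym\<close>)
  qed
  have "u \<in> word_class S u" "v \<in> word_class S v"
    using assms by (auto simp: word_class_def intro: free_group_rel.refl)
  then have "(\<Union>u'\<in>word_class S u. \<Union>v'\<in>word_class S v. word_class S (u' @ v')) = word_class S (u @ v)"
    using * by blast
  then show ?thesis
    by (simp add: free_group_def)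
qed

lemma free_group_left_inverse:
  "w \<in> words S \<Longrightarrow>
    (rev (map (\<lambda>(x, b). (x, \<not> b)) w) @ w, []) \<in> free_group_rel S"
proof (induction w)
  case Nil
  then show ?case by (auto intro: free_group_rel.refl)
next
  case (Cons a w)
  obtain x b where a: "a = (x, b)" by force
  have w: "w \<in> words S" "x \<in> S" using Cons.prems a by auto
  have iw: "rev (map (\<lambda>(x, b). (x, \<not> b)) w) \<in> words S"
    using w by (auto simp: in_lists_conv_set)
  show ?case
    using free_group_rel.trans[OF free_group_rel.cancel[OF iw w(1) w(2), of "\<not> b"] Cons.IH[OF w(1)]]
    by (simp add: a)
qed

lemma group_free_group: "group (free_group S)"
proof (rule groupI)
  fix A assume "A \<in> carrier (free_group S)"
  then obtain w where w: "w \<in> words S" "A = word_class S w"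
    by (auto simp: carrier_free_group)
  let ?v = "rev (map (\<lambda>(x, b). (x, \<not> b)) w)"
  have v: "?v \<in> words S"
    using w by (auto simp: in_lists_conv_set)
  have "word_class S ?v \<otimes>\<^bsub>free_group S\<^esub> A = \<one>\<^bsub>free_group S\<^esub>"
    using v w free_group_left_inverse[OF w(1)]
    by (simp add: mult_free_group one_free_group word_class_eq_iff del: lists_eq_set)
  then show "\<exists>B\<in>carrier (free_group S). B \<otimes>\<^bsub>free_group S\<^esub> A = \<one>\<^bsub>free_group S\<^esub>"
    using v unfolding carrier_free_group by blast
next
  fix A B assume "A \<in> carrier (free_group S)" "B \<in> carrier (free_group S)"
  then show "A \<otimes>\<^bsub>free_group S\<^esub> B \<in> carrier (free_group S)"
    unfolding carrier_free_group by (elim imageE) (simp add: mult_free_group del: lists_eq_set)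
next
  fix A B C
  assume "A \<in> carrier (free_group S)" "B \<in> carrier (free_group S)" "C \<in> carrier (free_group S)"
  then show "A \<otimes>\<^bsub>free_group S\<^esub> B \<otimes>\<^bsub>free_group S\<^esub> C = A \<otimes>\<^bsub>free_group S\<^esub> (B \<otimes>\<^bsub>free_group S\<^esub> C)"
    unfolding carrier_free_group by (elim imageE) (simp add: mult_free_group del: lists_eq_set)
next
  fix A assume "A \<in> carrier (free_group S)"
  then show "\<one>\<^bsub>free_group S\<^esub> \<otimes>\<^bsub>free_group S\<^esub> A = A"
    unfolding carrier_free_group by (elim imageE) (simp add: mult_free_group one_free_group del: lists_eq_set)
next
  show "\<one>\<^bsub>free_group S\<^esub> \<in> carrier (free_group S)"
    by (auto simp: carrier_free_group one_free_group)
qed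

end

theory Submission
  imports Defs "HOL-Algebra.FiniteProduct"
begin

text \<open>
  Let \<open>p = g\<^sub>1 \<cdots> g\<^sub>n\<close>.  The relation for \<open>k\<close> says \<open>p = g\<^sub>k\<^sup>2\<close>, so all generators have the same
  square (\<open>square_eq_product\<close>).  Hence the quotients \<open>h\<^sub>k = g\<^bsub>k+1\<^esub> g\<^sub>1\<^bsup>-1\<^esup>\<close> are involutions, and
  \<open>p\<^sup>2 = \<Prod>g\<^sub>k\<^sup>2 = p\<^sup>n\<close> gives \<open>g\<^sub>1\<^bsup>2n-4\<^esup> = p\<^bsup>n-2\<^esup> = 1\<close> (\<open>g_order\<close>).  The relation for \<open>n\<close> eliminates
  the last generator: \<open>g\<^sub>n = g\<^sub>1\<^bsup>n-1\<^esup> h\<^sub>1 \<cdots> h\<^bsub>n-2\<^esub>\<close> (\<open>combination_last\<close>).  So every element is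
  \<open>g\<^sub>1\<^sup>a \<Prod>h\<^sub>k\<^bsup>e(k)\<^esup>\<close>, where \<open>a\<close> matters modulo \<open>2n - 4\<close> and each exponent \<open>e(k)\<close> modulo \<open>2\<close>.

  That there is no further collapse is seen in \<open>T = C\<^sub>2\<^bsup>n-2\<^esup> \<times> C\<^bsub>2n-4\<^esub>\<close>.  Reading off exponents, send
  \<open>g\<^sub>1\<close> to \<open>(0, 1)\<close>, \<open>g\<^bsub>k+1\<^esub>\<close> to \<open>(\<epsilon>\<^sub>k, 1)\<close> with \<open>\<epsilon>\<^sub>k\<close> the \<open>k\<close>-th unit vector, and \<open>g\<^sub>n\<close> to
  \<open>((1, \<dots>, 1), n - 1)\<close>.  These images generate \<open>T\<close> (\<open>residue_gen_surj\<close>) and satisfy the defining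
  relations (\<open>residue_gen_complement\<close>): each of them doubles to \<open>(0, 2)\<close>, which is also their sum.
  In the other direction, \<open>(e, a) \<mapsto> g\<^sub>1\<^sup>a \<Prod>h\<^sub>k\<^bsup>e(k)\<^esup>\<close> is a homomorphism from \<open>T\<close> (\<open>combination_hom\<close>) taking
  the images back to the generators (\<open>combination_residue_gen\<close>).  By \<open>presented_group_iso\<close>, such a
  pair of maps makes the presented group isomorphic to \<open>T\<close>.
\<close>

(* The literal 1 in {1..n} is kept, and membership in words S is not turned into a bounded
   quantifier over the letters. *)
declare One_nat_def [simp del] in_listsD [rule del]

section \<open>Homomorphisms out of a presented group\<close>

text \<open>
  The value of a word in a group, each letter being replaced by its image under \<open>f\<close>; this is the
  extension of \<open>f\<close> to the free group, expressed on representatives.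
\<close>

primrec word_value :: "('b, 'c) monoid_scheme \<Rightarrow> ('a \<Rightarrow> 'b) \<Rightarrow> 'a word \<Rightarrow> 'b" where
  "word_value G f [] = \<one>\<^bsub>G\<^esub>"
| "word_value G f (l # w) =
    (if snd l then f (fst l) else inv\<^bsub>G\<^esub> f (fst l)) \<otimes>\<^bsub>G\<^esub> word_value G f w"

context group
begin

lemma word_value_closed:
  "f \<in> S \<rightarrow> carrier G \<Longrightarrow> w \<in> words S \<Longrightarrow> word_value G f w \<in> carrier G"
  by (induction w) (auto simp: Pi_iff)

lemma word_value_append:
  "f \<in> S \<rightarrow> carrier G \<Longrightarrow> u \<in> words S \<Longrightarrow> v \<in> words S \<Longrightarrow>
    word_value G f (u @ v) = word_value G f u \<otimes> word_value G f v"
proof (induction u)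
  case (Cons l u)
  then have "word_value G f u \<in> carrier G" "word_value G f v \<in> carrier G"
    by (auto intro!: word_value_closed[of f S])
  with Cons show ?case by (auto simp: m_assoc Pi_iff)
qed (auto intro!: l_one[symmetric] word_value_closed[of f S])

lemma word_value_respects:
  assumes f: "f \<in> S \<rightarrow> carrier G" and "(u, v) \<in> free_group_rel S"
  shows "word_value G f u = word_value G f v"
  using assms(2)
proof (induction rule: free_group_rel.induct)
  case (cancel u v x b)
  then have c: "f x \<in> carrier G" "word_value G f v \<in> carrier G"
    using f word_value_closed[OF f] by auto
  have w: "[(x, b), (x, \<not> b)] @ v \<in> words S"
    using cancel by auto
  have "word_value G f ([(x, b), (x, \<not> b)] @ v) = word_value G f v"
    using c by (cases b) (simp_all add: m_assoc[symmetric])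
  then show ?case
    using word_value_append[OF f cancel(1) w] word_value_append[OF f cancel(1,2)] by simp
qed auto

lemma word_value_hom:
  assumes f: "f \<in> S \<rightarrow> carrier G"
  obtains h where "h \<in> hom (free_group S) G"
    and "\<And>w. w \<in> words S \<Longrightarrow> h (word_class S w) = word_value G f w"
proof
  \<comment> \<open>The choice of representative is harmless because the value is constant on classes.\<close>
  define h where "h A = word_value G f (SOME w. w \<in> A)" for A
  show h: "h (word_class S w) = word_value G f w" if "w \<in> words S" for w
  proof -
    have "w \<in> word_class S w"
      using that by (simp add: word_class_def free_group_rel.refl)
    then have "(SOME v. v \<in> word_class S w) \<in> word_class S w"
      by (rule someI)
    then show ?thesis
      using word_value_respects[OF f] by (simp add: word_class_def h_def)
  qed
  show "h \<in> hom (free_group S) G"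
  proof (rule homI)
    fix A assume "A \<in> carrier (free_group S)"
    then show "h A \<in> carrier G"
      using h word_value_closed[OF f] by (auto simp: carrier_free_group)
  next
    fix A B assume "A \<in> carrier (free_group S)" "B \<in> carrier (free_group S)"
    then obtain u v where u: "u \<in> words S" "A = word_class S u" and v: "v \<in> words S" "B = word_class S v"
      by (auto simp: carrier_free_group)
    have "u @ v \<in> words S"
      using u v by simp
    then show "h (A \<otimes>\<^bsub>free_group S\<^esub> B) = h A \<otimes> h B"
      by (simp only: h mult_free_group u v word_value_append[OF f u(1) v(1)])
  qed
qed

text \<open>
  A group generated by pairwise commuting elements is abelian.  An element that commutes with all
  \<open>f x\<close> commutes with every word value; this is applied twice, to pass from letters to words on
  each side.
\<close>

lemma word_value_commute:
  assumes f: "f \<in> S \<rightarrow> carrier G"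
    and comm: "\<And>x y. x \<in> S \<Longrightarrow> y \<in> S \<Longrightarrow> f x \<otimes> f y = f y \<otimes> f x"
    and u: "u \<in> words S" and v: "v \<in> words S"
  shows "word_value G f u \<otimes> word_value G f v = word_value G f v \<otimes> word_value G f u"
proof -
  have inv_comm: "inv a \<otimes> b = b \<otimes> inv a"
    if "a \<otimes> b = b \<otimes> a" "a \<in> carrier G" "b \<in> carrier G" for a b
    using that by (metis inv_closed inv_solve_left inv_solve_right m_assoc m_closed)
  have mult_comm: "(a \<otimes> b) \<otimes> c = c \<otimes> (a \<otimes> b)"
    if "a \<otimes> c = c \<otimes> a" "b \<otimes> c = c \<otimes> b" "a \<in> carrier G" "b \<in> carrier G" "c \<in> carrier G" for a b c
    using that by (metis m_assoc)
  have commute_word: "c \<otimes> word_value G f w = word_value G f w \<otimes> c"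
    if "c \<in> carrier G" "w \<in> words S" "\<And>x. x \<in> S \<Longrightarrow> f x \<otimes> c = c \<otimes> f x" for c w
    using that(2)
  proof (induction w)
    case (Cons l w)
    then have "fst l \<in> S" "w \<in> words S" by auto
    moreover from this have "f (fst l) \<in> carrier G" "word_value G f w \<in> carrier G"
      using f word_value_closed[OF f] by auto
    ultimately show ?case
      using Cons.IH that(1,3) inv_comm mult_comm by auto
  qed (use that in simp)
  have "f x \<otimes> word_value G f v = word_value G f v \<otimes> f x" if "x \<in> S" for x
    using that f by (intro commute_word v comm) auto
  then show ?thesis
    using commute_word[OF word_value_closed[OF f v] u] by simp
qed

end

lemma (in comm_group) word_value_distinct:
  "f \<in> set xs \<rightarrow> carrier G \<Longrightarrow> distinct xs \<Longrightarrow> word_value G f (map gen xs) = finprod G f (set xs)"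
  by (induction xs) auto

lemma hom_word_value:
  assumes "h \<in> hom G H" "group G" "group H" "f \<in> S \<rightarrow> carrier G" "w \<in> words S"
  shows "h (word_value G f w) = word_value H (\<lambda>x. h (f x)) w"
proof -
  interpret group_hom G H h
    using assms by (simp add: group_hom_def group_hom_axioms_def)
  show ?thesis using assms(5)
  proof (induction w)
    case (Cons l w)
    then have "f (fst l) \<in> carrier G" "word_value G f w \<in> carrier G"
      using assms(4) by (auto intro!: G.word_value_closed[OF assms(4)])
    with Cons show ?case by auto
  qed simp
qed

lemma normal_closure_least: "N \<lhd> G \<Longrightarrow> A \<subseteq> N \<Longrightarrow> normal_closure G A \<subseteq> N"
  by (auto simp: normal_closure_def)

lemma subset_normal_closure: "A \<subseteq> normal_closure G A"
  by (auto simp: normal_closure_def)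

lemma (in group) normal_closure_normal:
  assumes "A \<subseteq> carrier G"
  shows "normal_closure G A \<lhd> G"
proof (rule normal_invI)
  have "carrier G \<lhd> G"
    by (rule normal_invI[OF subgroup_self]) auto
  then show "subgroup (normal_closure G A) G"
    unfolding normal_closure_def using assms
    by (intro subgroups_Inter) (auto dest: normal_imp_subgroup)
next
  fix x h assume "x \<in> carrier G" "h \<in> normal_closure G A"
  then show "x \<otimes> h \<otimes> inv x \<in> normal_closure G A"
    by (auto simp: normal_closure_def normal_inv_iff)
qed

text \<open>
  In the following locale \<open>F\<close> is the free group, \<open>N\<close> the normal closure of the relators, \<open>P = F / N\<close>,
  and \<open>pgen x\<close> the image of the generator \<open>x\<close> in \<open>P\<close>.
\<close>

locale presentation =
  fixes S :: "'a set" and R :: "('a word \<times> 'a word) set"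
  assumes relations_words: "R \<subseteq> words S \<times> words S"
begin

abbreviation F :: "'a word set monoid" where
  "F \<equiv> free_group S"

definition relators :: "'a word set set" where
  "relators = {word_class S u \<otimes>\<^bsub>F\<^esub> inv\<^bsub>F\<^esub> word_class S v | u v. (u, v) \<in> R}"

definition N :: "'a word set set" where
  "N = normal_closure F relators"

abbreviation P :: "'a word set set monoid" where
  "P \<equiv> presented_group S R"

definition pgen :: "'a \<Rightarrow> 'a word set set" where
  "pgen x = N #>\<^bsub>F\<^esub> word_class S [gen x]"

lemma presented_group_eq: "P = F Mod N"
  by (simp add: presented_group_def N_def relators_def)

sublocale F: group F
  by (rule group_free_group)

lemma word_class_closed: "w \<in> words S \<Longrightarrow> word_class S w \<in> carrier F"
  by (auto simp: carrier_free_group)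

lemma relators_closed: "relators \<subseteq> carrier F"
  using relations_words by (auto simp: relators_def intro!: word_class_closed)

sublocale N: normal N F
  unfolding N_def by (rule F.normal_closure_normal[OF relators_closed])

sublocale P: group P
  unfolding presented_group_eq by (rule N.factorgroup_is_group)

sublocale proj: group_hom F P "\<lambda>A. N #>\<^bsub>F\<^esub> A"
  using N.r_coset_hom_Mod by unfold_locales (simp add: presented_group_eq)

lemma pgen_closed: "pgen \<in> S \<rightarrow> carrier P"
  by (auto simp: pgen_def intro!: proj.hom_closed word_class_closed)

lemma word_value_letters:
  "w \<in> words S \<Longrightarrow> word_value F (\<lambda>x. word_class S [gen x]) w = word_class S w"
proof (induction w)
  case Nil
  then show ?case by (simp add: one_free_group)
next
  case (Cons l w)
  obtain x b where l: "l = (x, b)" by force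
  have x: "x \<in> S" and w: "w \<in> words S" using Cons.prems l by auto
  have inv: "inv\<^bsub>F\<^esub> word_class S [gen x] = word_class S [(x, False)]"
  proof (rule F.inv_equality)
    have "([(x, False), (x, True)], []) \<in> free_group_rel S"
      using free_group_rel.cancel[of "[]" S "[]" x False] x by simp
    then show "word_class S [(x, False)] \<otimes>\<^bsub>F\<^esub> word_class S [gen x] = \<one>\<^bsub>F\<^esub>"
      using x by (simp add: mult_free_group one_free_group word_class_eq_iff)
  qed (use x in \<open>auto intro!: word_class_closed\<close>)
  have "word_class S [(x, b)] \<otimes>\<^bsub>F\<^esub> word_class S w = word_class S ((x, b) # w)"
    using mult_free_group[of "[(x, b)]" S w] x w by simp
  then show ?case
    using Cons.IH w inv l by (cases b) auto
qed

lemma word_value_pgen: "w \<in> words S \<Longrightarrow> word_value P pgen w = N #>\<^bsub>F\<^esub> word_class S w"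
  using hom_word_value[OF proj.homh F.group_axioms P.group_axioms, of "\<lambda>x. word_class S [gen x]" S w]
  by (simp add: word_value_letters pgen_def[abs_def] word_class_closed)

lemma carrier_presented_group: "carrier P = word_value P pgen ` words S"
proof -
  have "carrier P = (\<lambda>w. N #>\<^bsub>F\<^esub> word_class S w) ` words S"
    by (simp add: presented_group_eq carrier_FactGroup carrier_free_group image_image)
  also have "\<dots> = word_value P pgen ` words S"
    by (simp add: word_value_pgen)
  finally show ?thesis .
qed

lemma relation_holds:
  assumes "(u, v) \<in> R"
  shows "word_value P pgen u = word_value P pgen v"
proof -
  have u: "u \<in> words S" and v: "v \<in> words S"
    using subsetD[OF relations_words assms] by simp_all
  note c = word_class_closed[OF u] word_class_closed[OF v]
  have "word_class S u \<otimes>\<^bsub>F\<^esub> inv\<^bsub>F\<^esub> word_class S v \<in> N"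
    using assms subset_normal_closure by (force simp: N_def relators_def)
  then have "N #>\<^bsub>F\<^esub> (word_class S u \<otimes>\<^bsub>F\<^esub> inv\<^bsub>F\<^esub> word_class S v) = \<one>\<^bsub>P\<^esub>"
    by (simp add: N.rcos_const presented_group_eq)
  then have "N #>\<^bsub>F\<^esub> word_class S u = N #>\<^bsub>F\<^esub> word_class S v"
    using c by (metis F.inv_closed P.inv_equality P.inv_inv proj.hom_closed proj.hom_inv proj.hom_mult)
  then show ?thesis
    using u v by (simp add: word_value_pgen)
qed

text \<open>
  Von Dyck's argument, with injectivity supplied by a map in the other direction.  The relations make
  \<open>f\<close> extend to a homomorphism \<open>h\<close> from \<open>F\<close> whose kernel contains \<open>N\<close>.  Since \<open>\<theta> \<circ> h\<close> agrees
  with the projection \<open>F \<rightarrow> P\<close> on generators, it is that projection, so the kernel of \<open>h\<close> is also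
  contained in \<open>N\<close>.
\<close>

theorem presented_group_iso:
  assumes T: "group T" and f: "f \<in> S \<rightarrow> carrier T"
    and rel: "\<And>u v. (u, v) \<in> R \<Longrightarrow> word_value T f u = word_value T f v"
    and surj: "carrier T \<subseteq> word_value T f ` words S"
    and \<theta>: "\<theta> \<in> hom T P" and inverse: "\<And>x. x \<in> S \<Longrightarrow> \<theta> (f x) = pgen x"
  shows "P \<cong> T"
proof -
  interpret T: group T by (rule T)
  obtain h where h: "h \<in> hom F T" and hw: "\<And>w. w \<in> words S \<Longrightarrow> h (word_class S w) = word_value T f w"
    using T.word_value_hom[OF f] by blast
  interpret h: group_hom F T h
    using h by unfold_locales
  have "relators \<subseteq> kernel F T h"
  proof
    fix r assume "r \<in> relators"
    then obtain u v where uv: "(u, v) \<in> R" and r: "r = word_class S u \<otimes>\<^bsub>F\<^esub> inv\<^bsub>F\<^esub> word_class S v"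
      by (auto simp: relators_def)
    then have "u \<in> words S" "v \<in> words S"
      using subsetD[OF relations_words uv] by simp_all
    then show "r \<in> kernel F T h"
      using rel[OF uv] T.word_value_closed[OF f]
      by (simp add: r kernel_def word_class_closed hw)
  qed
  then have "N \<subseteq> kernel F T h"
    unfolding N_def by (rule normal_closure_least[OF h.normal_kernel])
  moreover have "kernel F T h \<subseteq> N"
  proof
    fix A assume "A \<in> kernel F T h"
    then obtain w where w: "w \<in> words S" "A = word_class S w" and "h A = \<one>\<^bsub>T\<^esub>"
      by (auto simp: kernel_def carrier_free_group)
    then have "\<theta> (word_value T f w) = \<one>\<^bsub>P\<^esub>"
      using hom_one[OF \<theta> T P.group_axioms] by (simp add: hw)
    moreover have "\<theta> (word_value T f w) = word_value P (\<lambda>x. \<theta> (f x)) w"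
      by (rule hom_word_value[OF \<theta> T P.group_axioms f w(1)])
    moreover have "word_value P (\<lambda>x. \<theta> (f x)) w = word_value P pgen w"
      using w(1) by (induction w) (auto simp: inverse)
    ultimately have "N #>\<^bsub>F\<^esub> A = \<one>\<^bsub>P\<^esub>"
      using w by (simp add: word_value_pgen)
    then have "N #>\<^bsub>F\<^esub> A = N"
      by (simp add: presented_group_eq)
    then show "A \<in> N"
      using F.coset_join1 N.subset N.subgroup_axioms w word_class_closed by blast
  qed
  ultimately have "N = kernel F T h" ..
  moreover have "h ` carrier F = carrier T"
    using surj T.word_value_closed[OF f] by (auto simp: carrier_free_group image_image hw)
  ultimately show ?thesis
    using h.FactGroup_iso by (simp add: presented_group_eq)
qed

end

section \<open>Abelian groups with complementary generators\<close>

text \<open>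
  The relations of the presentation, imposed on elements of an arbitrary abelian group.
\<close>

locale complementary_family = comm_group G for G (structure) +
  fixes n :: nat and g :: "nat \<Rightarrow> 'a"
  assumes n_ge: "n \<ge> 3"
    and closed: "g \<in> {1..n} \<rightarrow> carrier G"
    and complement: "k \<in> {1..n} \<Longrightarrow> finprod G g ({1..n} - {k}) = g k"
begin

lemma g_closed [simp]: "k \<in> {1..n} \<Longrightarrow> g k \<in> carrier G"
  using closed by auto

lemma square_eq_product:
  assumes k: "k \<in> {1..n}"
  shows "g k \<otimes> g k = finprod G g {1..n}"
proof -
  have "finprod G g (insert k ({1..n} - {k})) = g k \<otimes> finprod G g ({1..n} - {k})"
    using k closed by (intro finprod_insert) auto
  then show ?thesis
    using k complement[OF k] by (simp add: insert_absorb)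
qed

text \<open>
  With \<open>p\<close> the product of the family, multiplying the \<open>n\<close> equations \<open>g\<^sub>k\<^sup>2 = p\<close> gives \<open>p\<^sup>2 = p\<^sup>n\<close>,
  hence \<open>g\<^sub>k\<^bsup>2n-4\<^esup> = p\<^bsup>n-2\<^esup> = 1\<close>.
\<close>

lemma g_order:
  assumes k: "k \<in> {1..n}"
  shows "g k [^] (2 * n - 4) = \<one>"
proof -
  define p where "p = finprod G g {1..n}"
  have p: "p \<in> carrier G"
    unfolding p_def using closed by (rule finprod_closed)
  have "p [^] n = (\<Otimes>i\<in>{1..n}. p)"
    using finprod_const[OF p, of "{1..n}"] by simp
  also have "\<dots> = (\<Otimes>i\<in>{1..n}. g i \<otimes> g i)"
    by (rule finprod_cong') (auto simp: square_eq_product p_def)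
  also have "\<dots> = p \<otimes> p"
    using closed by (simp add: p_def)
  finally have "p [^] n = p \<otimes> p" .
  moreover have "n - 2 + 2 = n"
    using n_ge by simp
  moreover have "p [^] (n - 2 + 2) = p [^] (n - 2) \<otimes> p [^] (2::nat)"
    by (rule nat_pow_mult[OF p, symmetric])
  moreover have "p [^] (2::nat) = p \<otimes> p"
    using p by (simp add: numeral_2_eq_2)
  ultimately have "p [^] (n - 2) \<otimes> (p \<otimes> p) = \<one> \<otimes> (p \<otimes> p)"
    using p by (metis l_one m_closed)
  then have "p [^] (n - 2) = \<one>"
    using right_cancel[of "p \<otimes> p" "p [^] (n - 2)" \<one>] p by simp
  moreover have "g k [^] (2 * (n - 2)) = (g k \<otimes> g k) [^] (n - 2)"
    using k nat_pow_pow[of "g k" 2 "n - 2"] by (simp add: numeral_2_eq_2)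
  ultimately show ?thesis
    using square_eq_product[OF k] by (simp add: p_def right_diff_distrib')
qed

definition involution :: "nat \<Rightarrow> 'a" where
  "involution k = g (Suc k) \<otimes> inv g 1"

lemma involution_closed [simp]: "k \<in> {1..n - 2} \<Longrightarrow> involution k \<in> carrier G"
  using n_ge by (auto simp: involution_def)

lemma involution_square:
  assumes "k \<in> {1..n - 2}"
  shows "involution k [^] (2::nat) = \<one>"
proof -
  have k: "Suc k \<in> {1..n}" and 1: "1 \<in> {1..n}"
    using assms n_ge by auto
  have "involution k [^] (2::nat) = (g (Suc k) \<otimes> g (Suc k)) \<otimes> inv (g 1 \<otimes> g 1)"
    using k 1 by (simp add: involution_def numeral_2_eq_2 inv_mult_group m_ac)
  then show ?thesis
    using k 1 finprod_closed[OF closed] by (simp only: square_eq_product r_inv)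
qed

text \<open>
  The exponents are integers here, so that additivity is immediate; reduction modulo \<open>2\<close> and
  \<open>2n - 4\<close> is a separate step.
\<close>

definition combination :: "(nat \<Rightarrow> int) \<Rightarrow> int \<Rightarrow> 'a" where
  "combination e a = g 1 [^] a \<otimes> (\<Otimes>k\<in>{1..n - 2}. involution k [^] e k)"

lemma combination_closed: "combination e a \<in> carrier G"
  using n_ge by (simp add: combination_def Pi_iff)

lemma combination_add:
  "combination (\<lambda>k. e k + e' k) (a + a') = combination e a \<otimes> combination e' a'"
proof -
  have 1: "1 \<in> {1..n}"
    using n_ge by simp
  have "(\<Otimes>k\<in>{1..n - 2}. involution k [^] (e k + e' k)) =
      (\<Otimes>k\<in>{1..n - 2}. involution k [^] e k \<otimes> involution k [^] e' k)"
    by (rule finprod_cong') (auto simp: int_pow_mult)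
  also have "\<dots> = (\<Otimes>k\<in>{1..n - 2}. involution k [^] e k) \<otimes> (\<Otimes>k\<in>{1..n - 2}. involution k [^] e' k)"
    by (rule finprod_multf) auto
  finally show ?thesis
    using 1 by (simp add: combination_def int_pow_mult m_ac)
qed

lemma int_pow_mod:
  assumes x: "x \<in> carrier G" and "x [^] (m::nat) = \<one>"
  shows "x [^] (a mod int m) = x [^] a"
proof -
  have "x [^] (int m * (a div int m)) = \<one>"
    using assms by (simp flip: int_pow_pow add: int_pow_int)
  then have "x [^] (int m * (a div int m) + a mod int m) = x [^] (a mod int m)"
    using x by (simp only: int_pow_mult int_pow_closed l_one)
  then show ?thesis by simp
qed

lemma combination_mod:
  assumes "\<And>k. k \<in> {1..n - 2} \<Longrightarrow> e' k = e k mod 2"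
  shows "combination e' (a mod int (2 * n - 4)) = combination e a"
proof -
  have "(\<Otimes>k\<in>{1..n - 2}. involution k [^] e' k) = (\<Otimes>k\<in>{1..n - 2}. involution k [^] e k)"
    using assms int_pow_mod[of "involution _" 2] involution_square
    by (intro finprod_cong') auto
  moreover have "g 1 [^] (a mod int (2 * n - 4)) = g 1 [^] a"
    using n_ge by (intro int_pow_mod g_order) auto
  ultimately show ?thesis
    by (simp add: combination_def)
qed

lemma combination_first: "combination (\<lambda>_. 0) 1 = g 1"
  using n_ge by (simp add: combination_def)

lemma combination_middle:
  assumes k: "k \<in> {1..n - 2}"
  shows "combination (\<lambda>i. of_bool (i = k)) 1 = g (Suc k)"
proof -
  have "(\<Otimes>i\<in>{1..n - 2}. involution i [^] (of_bool (i = k) :: int)) =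
      (\<Otimes>i\<in>{1..n - 2}. if k = i then involution i else \<one>)"
    using k by (intro finprod_cong') auto
  also have "\<dots> = involution k"
    using k by (intro finprod_singleton) auto
  finally have "combination (\<lambda>i. of_bool (i = k)) 1 = g 1 \<otimes> (g (Suc k) \<otimes> inv g 1)"
    using n_ge by (simp add: combination_def involution_def)
  moreover have "g 1 \<in> carrier G" "g (Suc k) \<in> carrier G"
    using k n_ge by auto
  ultimately show ?thesis
    by (simp add: m_lcomm[of "g 1" "g (Suc k)"])
qed

text \<open>
  The factors \<open>g\<^sub>1\<^bsup>-1\<^esup>\<close> of the \<open>n - 2\<close> involutions cancel all but one of the \<open>n - 1\<close> factors \<open>g\<^sub>1\<close>,
  which leaves \<open>g\<^sub>1 \<cdots> g\<^bsub>n-1\<^esub>\<close>.  This is \<open>g\<^sub>n\<close> by the relation for \<open>n\<close>.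
\<close>

lemma combination_last: "combination (\<lambda>_. 1) (int n - 1) = g n"
proof -
  have 1: "1 \<in> {1..n}"
    using n_ge by simp
  define q where "q = (\<Otimes>k\<in>{1..n - 2}. g (Suc k))"
  have gs: "(\<lambda>k. g (Suc k)) \<in> {1..n - 2} \<rightarrow> carrier G"
    using n_ge by auto
  then have q: "q \<in> carrier G"
    unfolding q_def by (rule finprod_closed)
  have "(\<Otimes>k\<in>{1..n - 2}. involution k [^] (1::int)) = (\<Otimes>k\<in>{1..n - 2}. g (Suc k) \<otimes> inv g 1)"
    by (rule finprod_cong') (auto simp flip: involution_def)
  also have "\<dots> = q \<otimes> (\<Otimes>k\<in>{1..n - 2}. inv g 1)"
    unfolding q_def using 1 gs by (intro finprod_multf) auto
  also have "(\<Otimes>k\<in>{1..n - 2}. inv g 1) = inv g 1 [^] (n - 2)"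
    using 1 finprod_const[of "inv g 1" "{1..n - 2}"] by simp
  also have "\<dots> = g 1 [^] (- int (n - 2))"
    using 1 by (simp add: int_pow_neg_int nat_pow_inv)
  finally have "combination (\<lambda>_. 1) (int n - 1) = g 1 [^] (int n - 1) \<otimes> (q \<otimes> g 1 [^] (- int (n - 2)))"
    by (simp add: combination_def)
  also have "\<dots> = q \<otimes> (g 1 [^] (int n - 1) \<otimes> g 1 [^] (- int (n - 2)))"
    using 1 q by (simp add: m_lcomm)
  also have "g 1 [^] (int n - 1) \<otimes> g 1 [^] (- int (n - 2)) = g 1"
    using 1 n_ge by (simp flip: int_pow_mult)
  also have "q \<otimes> g 1 = finprod G g ({1..n} - {n})"
  proof -
    have "{1..n} - {n} = insert 1 (Suc ` {1..n - 2})"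
      using n_ge image_Suc_atLeastAtMost[of 1 "n - 2"] by auto
    moreover have "finprod G g (Suc ` {1..n - 2}) = q"
      unfolding q_def using gs by (intro finprod_reindex) auto
    moreover have "finprod G g (insert 1 (Suc ` {1..n - 2})) = g 1 \<otimes> finprod G g (Suc ` {1..n - 2})"
      using 1 gs by (intro finprod_insert) (auto simp: Pi_iff)
    ultimately show ?thesis
      using 1 q by (simp add: m_comm)
  qed
  finally show ?thesis
    using complement[of n] n_ge by simp
qed

end

section \<open>Residue vectors\<close>

abbreviation C2_power_times_C :: "nat \<Rightarrow> ((nat \<Rightarrow> int) \<times> int) monoid" where
  "C2_power_times_C n \<equiv> product_group {1..n - 2} (\<lambda>_. integer_mod_group 2) \<times>\<times> integer_mod_group (2 * n - 4)"

text \<open>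
  Reduction of an integer vector to an element of the target group.  Computing with the integer
  vectors turns products in the target into ordinary sums, to be compared by \<open>residues_cong\<close>.
\<close>

definition residues :: "nat \<Rightarrow> (nat \<Rightarrow> int) \<Rightarrow> int \<Rightarrow> (nat \<Rightarrow> int) \<times> int" where
  "residues n e a = (\<lambda>k\<in>{1..n - 2}. e k mod 2, a mod int (2 * n - 4))"

text \<open>
  \<open>parity n i k\<close> and \<open>weight n i\<close> are the exponents of \<open>h\<^sub>k\<close> and of \<open>g\<^sub>1\<close> in \<open>g\<^sub>i\<close>.
\<close>

definition parity :: "nat \<Rightarrow> nat \<Rightarrow> nat \<Rightarrow> int" where
  "parity n i k = (if i = n \<or> i = Suc k then 1 else 0)"

definition weight :: "nat \<Rightarrow> nat \<Rightarrow> int" where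
  "weight n i = (if i = n then int n - 1 else 1)"

definition residue_gen :: "nat \<Rightarrow> nat \<Rightarrow> (nat \<Rightarrow> int) \<times> int" where
  "residue_gen n i = residues n (parity n i) (weight n i)"

lemma group_C2_power_times_C: "group (C2_power_times_C n)"
  by (intro DirProd_group product_group group_integer_mod_group)

lemma residues_mult:
  "residues n e a \<otimes>\<^bsub>C2_power_times_C n\<^esub> residues n e' a' = residues n (\<lambda>k. e k + e' k) (a + a')"
  by (auto simp: residues_def mod_add_eq restrict_def)

lemma residues_one: "\<one>\<^bsub>C2_power_times_C n\<^esub> = residues n (\<lambda>_. 0) 0"
  by (auto simp: residues_def)

lemma residues_closed: "n \<ge> 3 \<Longrightarrow> residues n e a \<in> carrier (C2_power_times_C n)"
  by (auto simp: residues_def carrier_integer_mod_group)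

lemma residues_of_carrier:
  assumes "n \<ge> 3" "x \<in> carrier (C2_power_times_C n)"
  shows "residues n (fst x) (snd x) = x"
proof (rule prod_eqI)
  have fst: "fst x \<in> {1..n - 2} \<rightarrow>\<^sub>E {0..<2}" and snd: "snd x \<in> {0..<int (2 * n - 4)}"
    using assms by (auto simp: carrier_integer_mod_group)
  have "fst x k mod 2 = fst x k" if "k \<in> {1..n - 2}" for k
    using PiE_mem[OF fst that] by simp
  then have "fst (residues n (fst x) (snd x)) = restrict (fst x) {1..n - 2}"
    by (auto simp: residues_def restrict_def)
  then show "fst (residues n (fst x) (snd x)) = fst x"
    using PiE_restrict[OF fst] by simp
  show "snd (residues n (fst x) (snd x)) = snd x"
    using snd by (simp add: residues_def)
qed

lemma residues_cong:
  assumes "\<And>k. k \<in> {1..n - 2} \<Longrightarrow> e k mod 2 = e' k mod 2"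
    and "a mod int (2 * n - 4) = a' mod int (2 * n - 4)"
  shows "residues n e a = residues n e' a'"
  using assms by (auto simp: residues_def restrict_def)

lemma word_value_residue_gen:
  "word_value (C2_power_times_C n) (residue_gen n) (map gen xs) =
    residues n (\<lambda>k. \<Sum>i\<leftarrow>xs. parity n i k) (\<Sum>i\<leftarrow>xs. weight n i)"
proof (induction xs)
  case Nil
  show ?case
    unfolding list.map word_value.simps residues_one by simp
next
  case (Cons i xs)
  show ?case
    unfolding list.map word_value.simps Cons.IH by (simp add: residue_gen_def residues_mult del: mult_DirProd)
qed

lemma sum_parity:
  assumes "k \<in> {1..n - 2}" "n \<ge> 3"
  shows "(\<Sum>i\<in>{1..n}. parity n i k) = 2"
proof -
  have "{1..n} \<inter> {i. i = n \<or> i = Suc k} = {n, Suc k}"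
    using assms by auto
  moreover have "card {n, Suc k} = 2"
    using assms by (subst card_insert_disjoint) auto
  ultimately show ?thesis
    by (simp add: parity_def sum.If_cases)
qed

lemma sum_weight:
  assumes "n \<ge> 3"
  shows "(\<Sum>i\<in>{1..n}. weight n i) = 2 * int n - 2"
proof -
  have "(\<Sum>i\<in>{1..n}. weight n i) = weight n n + (\<Sum>i\<in>{1..n} - {n}. weight n i)"
    using assms by (intro sum.remove) auto
  also have "(\<Sum>i\<in>{1..n} - {n}. weight n i) = (\<Sum>i\<in>{1..n} - {n}. 1)"
    by (rule sum.cong) (auto simp: weight_def)
  finally show ?thesis
    using assms by (simp add: weight_def)
qed

text \<open>
  The sum over \<open>j \<noteq> k\<close> is the total minus the \<open>k\<close>-th term.  The total is \<open>2\<close> in the first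
  components and \<open>2n - 2\<close>, congruent to \<open>2\<close>, in the last one; this is twice the \<open>k\<close>-th term.
\<close>

lemma residue_gen_complement:
  assumes n: "n \<ge> 3" and k: "k \<in> {1..n}"
  shows "word_value (C2_power_times_C n) (residue_gen n) (map gen (filter (\<lambda>j. j \<noteq> k) [1..<Suc n])) =
    residue_gen n k"
proof -
  let ?xs = "filter (\<lambda>j. j \<noteq> k) [1..<Suc n]"
  have sum_xs: "(\<Sum>i\<leftarrow>?xs. c i) = (\<Sum>i\<in>{1..n}. c i) - c k" for c :: "nat \<Rightarrow> int"
  proof -
    have "set ?xs = {1..n} - {k}" by auto
    then have "(\<Sum>i\<leftarrow>?xs. c i) = sum c ({1..n} - {k})"
      by (subst sum_list_distinct_conv_sum_set) auto
    then show ?thesis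
      using k by (simp add: sum_diff1)
  qed
  show ?thesis
    unfolding word_value_residue_gen residue_gen_def
  proof (rule residues_cong)
    fix l assume "l \<in> {1..n - 2}"
    then show "(\<Sum>i\<leftarrow>?xs. parity n i l) mod 2 = parity n k l mod 2"
      unfolding sum_xs using n by (simp only: sum_parity) (simp add: parity_def)
  next
    have m: "int (2 * n - 4) = 2 * int n - 4"
      using n by simp
    \<comment> \<open>The case \<open>k < n\<close>; for \<open>k = n\<close> the two sides are equal integers.\<close>
    have "2 * int n - 3 = 1 + (2 * int n - 4)" by simp
    then have "(2 * int n - 3) mod (2 * int n - 4) = 1 mod (2 * int n - 4)"
      by (metis mod_add_self2)
    then show "(\<Sum>i\<leftarrow>?xs. weight n i) mod int (2 * n - 4) = weight n k mod int (2 * n - 4)"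
      unfolding sum_xs m using n by (simp only: sum_weight) (auto simp: weight_def)
  qed
qed

text \<open>
  One letter \<open>k + 1\<close> for each nonzero \<open>e k\<close> produces the first components; then letters \<open>1\<close> adjust the
  last component without changing the others.
\<close>

lemma residue_gen_surj:
  assumes n: "n \<ge> 3" and x: "x \<in> carrier (C2_power_times_C n)"
  shows "x \<in> word_value (C2_power_times_C n) (residue_gen n) ` words {1..n}"
proof -
  define e a where "e = fst x" and "a = snd x"
  have e: "e k \<in> {0, 1}" if "k \<in> {1..n - 2}" for k
  proof -
    have "e \<in> {1..n - 2} \<rightarrow>\<^sub>E {0..<2}"
      using x by (auto simp: e_def carrier_integer_mod_group)
    from PiE_mem[OF this that] show ?thesis by auto
  qed
  define ks where "ks = filter (\<lambda>k. e k = 1) [1..<n - 1]"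
  define m where "m = nat ((a - int (length ks)) mod int (2 * n - 4))"
  define xs where "xs = map Suc ks @ replicate m 1"
  have ks: "set ks = {k \<in> {1..n - 2}. e k = 1}" "distinct ks"
    using n by (auto simp: ks_def)
  have "residues n (\<lambda>k. \<Sum>i\<leftarrow>xs. parity n i k) (\<Sum>i\<leftarrow>xs. weight n i) = residues n e a"
  proof (rule residues_cong)
    fix k assume k: "k \<in> {1..n - 2}"
    have "(\<Sum>i\<leftarrow>xs. parity n i k) = (\<Sum>j\<leftarrow>ks. parity n (Suc j) k)"
      using k n by (simp add: xs_def parity_def sum_list_replicate comp_def)
    also have "\<dots> = (\<Sum>j\<in>set ks. if j = k then 1 else 0)"
      unfolding sum_list_distinct_conv_sum_set[OF ks(2)]
    proof (rule sum.cong[OF HOL.refl])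
      fix j assume "j \<in> set ks"
      then have "Suc j \<noteq> n"
        using ks(1) n by auto
      then show "parity n (Suc j) k = (if j = k then 1 else 0)"
        by (simp add: parity_def)
    qed
    also have "\<dots> = e k"
      using e[OF k] k by simp (auto simp: ks(1))
    finally show "(\<Sum>i\<leftarrow>xs. parity n i k) mod 2 = e k mod 2" by simp
  next
    have "(\<Sum>j\<leftarrow>ks. weight n (Suc j)) = (\<Sum>j\<leftarrow>ks. 1)"
      using ks n by (intro arg_cong[where f = sum_list] map_cong) (auto simp: weight_def)
    then have "(\<Sum>i\<leftarrow>xs. weight n i) = int (length ks) + int m"
      using n by (simp add: xs_def weight_def sum_list_replicate sum_list_triv comp_def)
    also have "\<dots> mod int (2 * n - 4) = a mod int (2 * n - 4)"
      using n by (simp add: m_def mod_add_right_eq)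
    finally show "(\<Sum>i\<leftarrow>xs. weight n i) mod int (2 * n - 4) = a mod int (2 * n - 4)" .
  qed
  then have "x = word_value (C2_power_times_C n) (residue_gen n) (map gen xs)"
    using residues_of_carrier[OF n x] by (simp add: word_value_residue_gen e_def a_def)
  moreover have "map gen xs \<in> words {1..n}"
    using ks n by (auto simp: xs_def)
  ultimately show ?thesis by blast
qed

lemma (in complementary_family) combination_hom:
  "(\<lambda>x. combination (fst x) (snd x)) \<in> hom (C2_power_times_C n) G"
proof (rule homI)
  fix x y assume "x \<in> carrier (C2_power_times_C n)" "y \<in> carrier (C2_power_times_C n)"
  then have "x \<otimes>\<^bsub>C2_power_times_C n\<^esub> y = residues n (\<lambda>k. fst x k + fst y k) (snd x + snd y)"
    using residues_mult[of n "fst x" "snd x" "fst y" "snd y"] by (simp only: residues_of_carrier[OF n_ge])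
  then show "combination (fst (x \<otimes>\<^bsub>C2_power_times_C n\<^esub> y)) (snd (x \<otimes>\<^bsub>C2_power_times_C n\<^esub> y)) =
      combination (fst x) (snd x) \<otimes> combination (fst y) (snd y)"
    by (simp only: residues_def fst_conv snd_conv combination_mod restrict_apply' combination_add)
qed (rule combination_closed)

lemma (in complementary_family) combination_residue_gen:
  assumes i: "i \<in> {1..n}"
  shows "combination (fst (residue_gen n i)) (snd (residue_gen n i)) = g i"
proof -
  have cong: "combination e a = combination e' a" if "\<And>k. k \<in> {1..n - 2} \<Longrightarrow> e k = e' k" for e e' a
    using that unfolding combination_def
    by (intro arg_cong2[where f = "(\<otimes>)"] finprod_cong') auto
  have "combination (fst (residue_gen n i)) (snd (residue_gen n i)) = combination (parity n i) (weight n i)"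
    unfolding residue_gen_def residues_def fst_conv snd_conv by (rule combination_mod) simp
  also have "\<dots> = g i"
  proof -
    consider "i = 1" | "i = n" | k where "i = Suc k" "k \<in> {1..n - 2}"
      using i by (cases i) force+
    then show ?thesis
    proof cases
      case 1
      then have "combination (parity n i) (weight n i) = combination (\<lambda>_. 0) 1"
        using n_ge by (simp add: weight_def) (intro cong, simp add: parity_def)
      then show ?thesis using 1 combination_first by simp
    next
      case 2
      then have "parity n i = (\<lambda>_. 1)" by (auto simp: parity_def)
      then show ?thesis using 2 combination_last by (simp add: weight_def)
    next
      case 3
      then have "parity n i = (\<lambda>j. of_bool (j = k))" "weight n i = 1"
        using n_ge by (auto simp: parity_def weight_def fun_eq_iff)
      then show ?thesis using 3 combination_middle by simp
    qed
  qed
  finally show ?thesis .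
qed

theorem proposition3p1:
  fixes n :: nat
  assumes "n \<ge> 3"
  shows "G_pres n \<cong> product_group {1..n - 2} (\<lambda>_. integer_mod_group 2) \<times>\<times> integer_mod_group (2 * n - 4)"
proof -
  interpret presentation "{1..n}" "G_relations n"
    by unfold_locales (auto simp: G_relations_def)
  have comm: "pgen i \<otimes>\<^bsub>P\<^esub> pgen j = pgen j \<otimes>\<^bsub>P\<^esub> pgen i" if "i \<in> {1..n}" "j \<in> {1..n}" for i j
  proof -
    have "([gen i, gen j], [gen j, gen i]) \<in> G_relations n"
      using that by (auto simp: G_relations_def)
    from relation_holds[OF this] show ?thesis
      using that pgen_closed by (simp add: Pi_iff)
  qed
  interpret P: comm_group P
  proof (rule P.group_comm_groupI)
    fix x y assume "x \<in> carrier P" "y \<in> carrier P"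
    then show "x \<otimes>\<^bsub>P\<^esub> y = y \<otimes>\<^bsub>P\<^esub> x"
      unfolding carrier_presented_group using P.word_value_commute[OF pgen_closed comm] by blast
  qed
  interpret family: complementary_family P n pgen
  proof
    fix k assume k: "k \<in> {1..n}"
    let ?xs = "filter (\<lambda>j. j \<noteq> k) [1..<Suc n]"
    have set: "set ?xs = {1..n} - {k}" by auto
    have "(map gen ?xs, [gen k]) \<in> G_relations n"
      using k by (auto simp: G_relations_def)
    from relation_holds[OF this] have "word_value P pgen (map gen ?xs) = pgen k"
      using k pgen_closed by (simp add: Pi_iff)
    moreover have "word_value P pgen (map gen ?xs) = finprod P pgen ({1..n} - {k})"
      using P.word_value_distinct[of pgen ?xs] pgen_closed unfolding set
      by (auto simp del: upt_Suc)
    ultimately show "finprod P pgen ({1..n} - {k}) = pgen k" by simp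
  qed (use assms pgen_closed in auto)
  let ?T = "C2_power_times_C n"
  interpret T: group ?T
    by (rule group_C2_power_times_C)
  have gen_closed: "residue_gen n \<in> {1..n} \<rightarrow> carrier ?T"
    using residues_closed[OF assms] by (simp add: residue_gen_def)
  have "word_value ?T (residue_gen n) u = word_value ?T (residue_gen n) v"
    if "(u, v) \<in> G_relations n" for u v
    using that unfolding G_relations_def
  proof (elim UnE CollectE exE conjE Pair_inject, goal_cases)
    case (1 i j)
    then show ?case
      using word_value_residue_gen[of n "[i, j]"] word_value_residue_gen[of n "[j, i]"]
      by (simp add: add.commute del: word_value.simps)
  next
    case (2 k)
    then show ?case
      using residue_gen_complement[OF assms] gen_closed by (simp add: Pi_iff del: mult_DirProd)
  qed
  then have "P \<cong> ?T"
    using T.group_axioms gen_closed residue_gen_surj[OF assms]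
      family.combination_hom family.combination_residue_gen
    by (intro presented_group_iso) auto
  then show ?thesis
    by (simp add: G_pres_def)
qed

end
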